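(* Let $G=\bigoplus_{i=1}^n\bigoplus_{j=1}^{n_i}C_{p_i^{e_{ij}}}$ be a finite abelian group (written as a direct sum of prime-power cyclic groups, with $p_1,\dots,p_n$ distinct primes) such that $k(G)=k^*(G)$. Let $S$ be a UFIM over $G\setminus\{0\}$ with irreducible factorization $\bigsqcup_{i=1}^m I_i$. If $$m\le\sum_{i=1}^n\sum_{j=1}^{n_i}\frac{P^-(|G|)}{p_i}K_1^*(C_{p_i^{e_{ij}}}),$$ then $k(S)\le K_1^*(G)$. In particular, for a finite abelian $p$-group $G$ ($p$ prime) and a UFIM $S$ over $G\setminus\{0\}$ with $m$ irreducible factors, if $m\le K_1^*(G)$, then $k(S)\le K_1^*(G)$.
   Context: Groups are finite abelian, written additively; $C_n$ is the cyclic group of order $n$. An indexed multiset $S=\{g_1,\ldots,g_\ell\}$ over a set $X\subseteq G$ is a finite (possibly empty) indexed family of elements of $X$; for $I\subseteq[\ell]$ put $S(I)=\{g_i : i\in I\}$, and submultisets of $S$ are the $S(I)$. Put $\sigma(S)=\sum_{g\in S}g$ (with multiplicity), $\sigma(\emptyset)=0$. $S$ is zero-sum if $\sigma(S)=0$; minimal zero-sum if $\sigma(S)=0$ and $\sigma(S')\ne0$ for every $\emptyset\subsetneq S'\subsetneq S$; zero-sum free if $\sigma(S')\neq0$ for every $\emptyset\subsetneq S'\subseteq S$. An irreducible factorization of $S$ over $G\setminus\{0\}$ is a partition $[\ell]=\bigsqcup_{i=1}^m I_i$ into nonempty sets with each $S(I_i)$ minimal zero-sum (the $S(I_i)$ are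 the irreducible factors); two factorizations are equivalent iff they are the same set of blocks $\{I_1,\ldots,I_m\}$. A unique factorization indexed multiset (UFIM) over $G\setminus\{0\}$ is a zero-sum indexed multiset over $G\setminus\{0\}$ with exactly one irreducible factorization up to equivalence. The cross number of $S$ is $k(S)=\sum_{g\in S}\frac1{\mathrm{ord}(g)}$ (with multiplicity; $k(\emptyset)=0$), and $k(G)=\max\{k(S): S\text{ is a zero-sum free indexed multiset over }G\setminus\{0\}\}$. For $G=\bigoplus_{i=1}^n\bigoplus_{j=1}^{n_i}C_{p_i^{e_{ij}}}$ with distinct primes $p_i$ and $e_{ij}\ge1$, put $K_1^*(G)=\sum_{i=1}^n\sum_{j=1}^{n_i}\frac{p_i^{e_{ij}}-1}{p_i^{e_{ij}}-p_i^{e_{ij}-1}}$ and $k^*(G)=\sum_{i=1}^n\sum_{j=1}^{n_i}\frac{p_i^{e_{ij}}-1}{p_i^{e_{ij}}}$. $P^-(N)$ denotes the smallest prime divisor of $N$. *)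

theory Defs
  imports Complex_Main "HOL-Library.Disjoint_Sets" "HOL-Computational_Algebra.Primes"
    "HOL-Algebra.Product_Groups" "HOL-Algebra.Multiplicative_Group"
begin

text \<open>
  Abelian groups are written multiplicatively, following HOL-Algebra: \<open>\<one>\<close> is the zero of
  the group and \<^const>\<open>finprod\<close> is the sum.  An indexed multiset of length \<open>l\<close> is a function
  \<open>g\<close> restricted to \<open>{1..l}\<close>; its submultisets are the restrictions of \<open>g\<close> to the subsets
  \<open>I\<close> of \<open>{1..l}\<close>.  The predicates below therefore take an arbitrary finite index set \<open>I\<close>.
\<close>

definition indexed_multiset :: "('a, 'b) monoid_scheme \<Rightarrow> nat \<Rightarrow> (nat \<Rightarrow> 'a) \<Rightarrow> bool" where
  "indexed_multiset G l g \<longleftrightarrow> g \<in> {1..l} \<rightarrow> carrier G - {\<one>\<^bsub>G\<^esub>}"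

definition zero_sum :: "('a, 'b) monoid_scheme \<Rightarrow> (nat \<Rightarrow> 'a) \<Rightarrow> nat set \<Rightarrow> bool" where
  "zero_sum G g I \<longleftrightarrow> finprod G g I = \<one>\<^bsub>G\<^esub>"

definition minimal_zero_sum :: "('a, 'b) monoid_scheme \<Rightarrow> (nat \<Rightarrow> 'a) \<Rightarrow> nat set \<Rightarrow> bool" where
  "minimal_zero_sum G g I \<longleftrightarrow>
     zero_sum G g I \<and> (\<forall>J. J \<noteq> {} \<and> J \<subset> I \<longrightarrow> \<not> zero_sum G g J)"

definition zero_sum_free :: "('a, 'b) monoid_scheme \<Rightarrow> (nat \<Rightarrow> 'a) \<Rightarrow> nat set \<Rightarrow> bool" where
  "zero_sum_free G g I \<longleftrightarrow> (\<forall>J. J \<noteq> {} \<and> J \<subseteq> I \<longrightarrow> \<not> zero_sum G g J)"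

text \<open>A factorization is the set of its blocks, so equivalence of factorizations is equality.\<close>

definition irreducible_factorization ::
    "('a, 'b) monoid_scheme \<Rightarrow> nat \<Rightarrow> (nat \<Rightarrow> 'a) \<Rightarrow> nat set set \<Rightarrow> bool" where
  "irreducible_factorization G l g P \<longleftrightarrow>
     partition_on {1..l} P \<and> (\<forall>I\<in>P. minimal_zero_sum G g I)"

definition UFIM :: "('a, 'b) monoid_scheme \<Rightarrow> nat \<Rightarrow> (nat \<Rightarrow> 'a) \<Rightarrow> bool" where
  "UFIM G l g \<longleftrightarrow>
     indexed_multiset G l g \<and> zero_sum G g {1..l} \<and> (\<exists>!P. irreducible_factorization G l g P)"

definition cross_number :: "('a, 'b) monoid_scheme \<Rightarrow> nat \<Rightarrow> (nat \<Rightarrow> 'a) \<Rightarrow> real" where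
  "cross_number G l g = (\<Sum>i\<in>{1..l}. 1 / real (group.ord G (g i)))"

text \<open>For finite \<open>G\<close> the set is finite and nonempty: a zero-sum free multiset has fewer than
  \<open>|G|\<close> elements, and the empty one is zero-sum free.\<close>

definition group_cross_number :: "('a, 'b) monoid_scheme \<Rightarrow> real" where
  "group_cross_number G =
     Max {cross_number G l g | l g. indexed_multiset G l g \<and> zero_sum_free G g {1..l}}"

text \<open>\<open>G\<close> is the direct sum of the cyclic groups of order \<open>p i ^ e i j\<close>, where \<open>1 \<le> i \<le> n\<close>
  and \<open>1 \<le> j \<le> r i\<close>, with \<open>p 1, \<dots>, p n\<close> distinct primes.\<close>

definition prime_power_decomposition ::
    "('a, 'b) monoid_scheme \<Rightarrow> nat \<Rightarrow> (nat \<Rightarrow> nat) \<Rightarrow> (nat \<Rightarrow> nat) \<Rightarrow> (nat \<Rightarrow> nat \<Rightarrow> nat) \<Rightarrow> bool"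
  where
  "prime_power_decomposition G n r p e \<longleftrightarrow>
     (\<forall>i\<in>{1..n}. prime (p i)) \<and> inj_on p {1..n} \<and>
     (\<forall>i\<in>{1..n}. \<forall>j\<in>{1..r i}. 1 \<le> e i j) \<and>
     G \<cong> sum_group (SIGMA i:{1..n}. {1..r i}) (\<lambda>(i, j). integer_mod_group (p i ^ e i j))"

text \<open>The invariants of a group are given as functions of its decomposition.\<close>

definition K1_star ::
    "nat \<Rightarrow> (nat \<Rightarrow> nat) \<Rightarrow> (nat \<Rightarrow> nat) \<Rightarrow> (nat \<Rightarrow> nat \<Rightarrow> nat) \<Rightarrow> real" where
  "K1_star n r p e =
     (\<Sum>i\<in>{1..n}. \<Sum>j\<in>{1..r i}.
        (real (p i) ^ e i j - 1) / (real (p i) ^ e i j - real (p i) ^ (e i j - 1)))"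

definition k_star ::
    "nat \<Rightarrow> (nat \<Rightarrow> nat) \<Rightarrow> (nat \<Rightarrow> nat) \<Rightarrow> (nat \<Rightarrow> nat \<Rightarrow> nat) \<Rightarrow> real" where
  "k_star n r p e =
     (\<Sum>i\<in>{1..n}. \<Sum>j\<in>{1..r i}. (real (p i) ^ e i j - 1) / real (p i) ^ e i j)"

text \<open>\<^const>\<open>K1_star\<close> of the single cyclic group of order \<open>q ^ a\<close>.\<close>

definition K1_star_cyclic :: "nat \<Rightarrow> nat \<Rightarrow> real" where
  "K1_star_cyclic q a = K1_star 1 (\<lambda>_. 1) (\<lambda>_. q) (\<lambda>_ _. a)"

definition finite_p_group :: "nat \<Rightarrow> ('a, 'b) monoid_scheme \<Rightarrow> bool" where
  "finite_p_group q G \<longleftrightarrow> prime q \<and> (\<exists>a. card (carrier G) = q ^ a)"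

text \<open>Unspecified for \<open>N = 1\<close>, which has no prime divisor.\<close>

definition smallest_prime_divisor :: "nat \<Rightarrow> nat" where
  "smallest_prime_divisor N = Min {q. prime q \<and> q dvd N}"

end

theory Submission
  imports Defs "HOL-Library.Function_Algebras" "HOL-Library.Multiset"
begin

text \<open>
  In a UFIM every zero-sum submultiset is a union of blocks, so deleting one element from each
  block leaves a zero-sum free multiset.  Each of the \<open>m\<close> deleted elements has order at least
  \<open>P\<^sup>-(|G|)\<close>, hence \<open>k(S) \<le> k(G) + m / P\<^sup>-(|G|)\<close>, and the bound follows from
  \<open>K\<^sub>1\<^sup>*(C) = k\<^sup>*(C) + K\<^sub>1\<^sup>*(C) / p\<close> for every cyclic \<open>p\<close>-group \<open>C\<close>.

  For a \<open>p\<close>-group the inequality \<open>k(G) \<le> k\<^sup>*(G)\<close> has to be proved.  Functions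
  \<open>\<phi> : \<int>\<^sup>r \<rightarrow> \<int>\<close> are considered modulo \<open>p\<close>, together with the difference
  operators \<open>\<phi>(x) - \<phi>(x + h)\<close>.  Giving the difference along the \<open>i\<close>-th basis vector the weight
  \<open>p\<^bsup>-e\<^sub>i\<^esup>\<close>, the indicator function of the relation lattice of \<open>G\<close> has weighted
  degree at most \<open>k\<^sup>*(G)\<close>, and the difference along an element of order \<open>p\<^sup>a\<close> lowers the
  degree by \<open>p\<^bsup>-a\<^esup>\<close>.  Differencing along all elements of a zero-sum free multiset gives a
  function with value \<open>1\<close> at \<open>0\<close>, so the degree cannot become negative.
\<close>

subsection \<open>Weighted degrees and difference operators\<close>

text \<open>The sign keeps the formal coefficient of \<open>\<phi> x\<close> equal to 1 under
  iteration. The ring structure lets \<open>of_nat n * t\<close> express multiples of a direction;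
  later it is \<open>'i \<Rightarrow> int\<close>, pointwise.\<close>

definition difference :: "'m::comm_ring_1 \<Rightarrow> ('m \<Rightarrow> int) \<Rightarrow> 'm \<Rightarrow> int" where
  "difference h \<phi> x = \<phi> x - \<phi> (x + h)"

lemma difference_commute: "difference h (difference k \<phi>) = difference k (difference h \<phi>)"
  by (simp add: difference_def fun_eq_iff algebra_simps)

lemma comp_fun_commute_difference: "comp_fun_commute (\<lambda>i. difference (b i))"
  by standard (auto simp: fun_eq_iff difference_commute)

lemma difference_funpow:
  "(difference t ^^ n) \<phi> x = (\<Sum>k\<le>n. (-1) ^ k * int (n choose k) * \<phi> (x + of_nat k * t))"
proof (induction n arbitrary: x)
  case 0
  then show ?case by simp
next
  case (Suc n)
  let ?a = "\<lambda>k. \<phi> (x + of_nat k * t)"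
  have "(difference t ^^ Suc n) \<phi> x = (difference t ^^ n) \<phi> x - (difference t ^^ n) \<phi> (x + t)"
    by (simp add: difference_def)
  also have "\<dots> = (\<Sum>k\<le>n. (-1) ^ k * int (n choose k) * ?a k)
      - (\<Sum>k\<le>n. (-1) ^ k * int (n choose k) * ?a (Suc k))"
    unfolding Suc by (simp add: algebra_simps)
  \<comment> \<open>The added coefficient \<open>n choose Suc n\<close> is 0. Splitting off
    \<open>k = 0\<close> then puts both sums over \<open>?a (Suc k)\<close>, where Pascal's rule
    combines them.\<close>
  also have "(\<Sum>k\<le>n. (-1) ^ k * int (n choose k) * ?a k)
      = (\<Sum>k\<le>Suc n. (-1) ^ k * int (n choose k) * ?a k)"
    by (simp add: binomial_eq_0)
  also have "\<dots> = ?a 0 + (\<Sum>k\<le>n. (-1) ^ Suc k * int (n choose Suc k) * ?a (Suc k))"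
    by (subst sum.atMost_Suc_shift) simp
  also have "\<dots> - (\<Sum>k\<le>n. (-1) ^ k * int (n choose k) * ?a (Suc k))
      = ?a 0 + (\<Sum>k\<le>n. (-1) ^ Suc k * int (Suc n choose Suc k) * ?a (Suc k))"
    unfolding add_diff_eq[symmetric] sum_subtractf[symmetric]
    by (intro arg_cong2[of _ _ _ _ "(+)"] sum.cong refl) (simp add: algebra_simps)
  also have "\<dots> = (\<Sum>k\<le>Suc n. (-1) ^ k * int (Suc n choose k) * ?a k)"
    by (subst sum.atMost_Suc_shift) simp
  finally show ?case .
qed

text \<open>Frobenius: with T the shift by \<open>t\<close>, (1 - T)^q is 1 - T^q modulo q, since q
  divides the inner binomial coefficients.\<close>

lemma difference_funpow_prime:
  assumes "prime q"
  shows "int q dvd (difference t ^^ q) \<phi> x - difference (of_nat q * t) \<phi> x"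
proof -
  let ?f = "\<lambda>k. (-1) ^ k * int (q choose k) * \<phi> (x + of_nat k * t)"
  have q: "q \<noteq> 0" using assms by (auto simp: prime_gt_0_nat)
  have "{..q} = insert 0 (insert q {1..<q})" by auto
  then have "(difference t ^^ q) \<phi> x = ?f 0 + (?f q + sum ?f {1..<q})"
    unfolding difference_funpow using q by simp
  then have "(difference t ^^ q) \<phi> x - difference (of_nat q * t) \<phi> x
      = ((-1) ^ q + 1) * \<phi> (x + of_nat q * t) + sum ?f {1..<q}"
    by (simp add: difference_def algebra_simps)
  moreover have "int q dvd sum ?f {1..<q}"
    using assms q by (intro dvd_sum dvd_mult2 dvd_mult) (auto intro!: dvd_choose_prime)
  \<comment> \<open>The sign of the last term is wrong only for \<open>q = 2\<close>, where the
    discrepancy 2 vanishes modulo \<open>q\<close>.\<close>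
  moreover have "int q dvd (-1) ^ q + 1"
  proof (cases "q = 2")
    case False
    then have "odd q" using prime_odd_nat[OF assms] prime_ge_2_nat[OF assms] by simp
    then show ?thesis by simp
  qed simp
  ultimately show ?thesis by simp
qed

lemma dvd_difference_funpow:
  assumes "\<And>x. m dvd \<phi> x - \<psi> x"
  shows "m dvd (difference t ^^ n) \<phi> x - (difference t ^^ n) \<psi> x"
proof (induction n arbitrary: x)
  case (Suc n)
  show ?case
    using dvd_diff[OF Suc[of x] Suc[of "x + t"]] by (simp add: difference_def algebra_simps)
qed (simp add: assms)

text \<open>Iterates Frobenius: the \<open>q ^ Suc s\<close>-th power is the \<open>q\<close>-th
  power of the \<open>q ^ s\<close>-th.\<close>

lemma difference_funpow_prime_power:
  assumes "prime q"
  shows "int q dvd (difference t ^^ (q ^ s)) \<phi> x - difference (of_nat (q ^ s) * t) \<phi> x"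
proof (induction s arbitrary: \<phi> x)
  case outer: (Suc s)
  define D where "D = difference t ^^ (q ^ s)"
  \<comment> \<open>The hypothesis for \<open>s\<close> is only a congruence modulo
    \<open>q\<close>, so it is substituted into the iterate one factor at a time.\<close>
  have D: "int q dvd (D ^^ n) \<phi> x - (difference (of_nat (q ^ s) * t) ^^ n) \<phi> x" for n x
  proof (induction n arbitrary: x)
    case (Suc n)
    let ?\<psi> = "(D ^^ n) \<phi>" and ?\<psi>' = "(difference (of_nat (q ^ s) * t) ^^ n) \<phi>" and ?t = "of_nat (q ^ s) * t"
    have "int q dvd D ?\<psi> x - difference ?t ?\<psi> x"
      unfolding D_def by (rule outer.IH)
    moreover have "int q dvd difference ?t ?\<psi> x - difference ?t ?\<psi>' x"
      using dvd_difference_funpow[where n = 1 and t = ?t and m = "int q" and \<phi> = ?\<psi> and \<psi> = ?\<psi>'] Suc by simp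
    ultimately show ?case
      using dvd_add by fastforce
  qed simp
  have "(difference t ^^ (q ^ Suc s)) = D ^^ q"
    unfolding D_def funpow_mult by (simp add: mult.commute)
  moreover have "int q dvd (difference (of_nat (q ^ s) * t) ^^ q) \<phi> x - difference (of_nat (q ^ Suc s) * t) \<phi> x"
    using difference_funpow_prime[OF assms, of "of_nat (q ^ s) * t" \<phi> x] by (simp add: algebra_simps)
  ultimately show ?case
    using dvd_add[OF D[of q x]] by fastforce
qed simp

lemma sum_image_mset_eq_sum_count:
  fixes f :: "'a \<Rightarrow> real"
  assumes "set_mset M \<subseteq> A" "finite A"
  shows "(\<Sum>i\<in>#M. f i) = (\<Sum>i\<in>A. real (count M i) * f i)"
  using assms
proof (induction M)
  case (add j M)
  have "real (count (add_mset j M) i) * f i = (if i = j then f i else 0) + real (count M i) * f i" for i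
    by (simp add: algebra_simps)
  then show ?case
    using add by (simp add: sum.distrib)
qed simp

section \<open>Weighted degree modulo a prime\<close>

locale weighted_differences =
  fixes q :: nat and A :: "'i set" and b :: "'i \<Rightarrow> 'm::comm_ring_1" and \<omega> :: "'i \<Rightarrow> real"
  assumes prime_q: "prime q"
begin

interpretation comp_fun_commute "\<lambda>i. difference (b i)"
  by (rule comp_fun_commute_difference)

abbreviation mixed_difference :: "('m \<Rightarrow> int) \<Rightarrow> 'i multiset \<Rightarrow> 'm \<Rightarrow> int" where
  "mixed_difference \<equiv> fold_mset (\<lambda>i. difference (b i))"

text \<open>Modelled on polynomial degree, which repeated differences exhaust. For
  \<open>w < 0\<close> the empty multiset qualifies, so \<open>\<phi>\<close> itself vanishes modulo
  \<open>q\<close>.\<close>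

definition degree_le :: "real \<Rightarrow> ('m \<Rightarrow> int) \<Rightarrow> bool" where
  "degree_le w \<phi> \<longleftrightarrow>
     (\<forall>M. set_mset M \<subseteq> A \<and> w < (\<Sum>i\<in>#M. \<omega> i) \<longrightarrow> (\<forall>x. int q dvd mixed_difference \<phi> M x))"

lemma mixed_difference_add_mset:
  "mixed_difference \<phi> (add_mset i M) x = mixed_difference \<phi> M x - mixed_difference \<phi> M (x + b i)"
  by (simp only: fold_mset_add_mset difference_def)

lemma mixed_difference_add:
  "mixed_difference (\<lambda>x. \<phi> x + \<psi> x) M x = mixed_difference \<phi> M x + mixed_difference \<psi> M x"
  by (induction M arbitrary: x) (auto simp: difference_def)

lemma mixed_difference_shift: "mixed_difference (\<lambda>x. \<phi> (x + h)) M x = mixed_difference \<phi> M (x + h)"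
  by (induction M arbitrary: x) (auto simp: difference_def algebra_simps)

lemma dvd_mixed_difference:
  "(\<And>x. int q dvd \<phi> x - \<psi> x) \<Longrightarrow> int q dvd mixed_difference \<phi> M x - mixed_difference \<psi> M x"
proof (induction M arbitrary: x)
  case (add i M)
  then show ?case
    using dvd_diff[OF add.IH[of x] add.IH[of "x + b i"]]
    by (simp only: mixed_difference_add_mset) (simp add: algebra_simps)
qed simp

lemma mixed_difference_replicate:
  "mixed_difference \<phi> (replicate_mset n i) = (difference (b i) ^^ n) \<phi>"
  by (induction n) auto

lemma degree_le_add: "degree_le w \<phi> \<Longrightarrow> degree_le w \<psi> \<Longrightarrow> degree_le w (\<lambda>x. \<phi> x + \<psi> x)"
  by (auto simp: degree_le_def mixed_difference_add)

lemma degree_le_shift: "degree_le w \<phi> \<Longrightarrow> degree_le w (\<lambda>x. \<phi> (x + h))"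
  by (auto simp: degree_le_def mixed_difference_shift)

lemma degree_le_mono: "degree_le w \<phi> \<Longrightarrow> w \<le> w' \<Longrightarrow> degree_le w' \<phi>"
  unfolding degree_le_def by (meson le_less_trans)

lemma degree_le_cong:
  assumes "degree_le w \<phi>" "\<And>x. int q dvd \<phi> x - \<psi> x"
  shows "degree_le w \<psi>"
  using assms(1) dvd_mixed_difference[of \<phi> \<psi>, OF assms(2)]
  unfolding degree_le_def by (metis dvd_diff_right_iff)

lemma degree_le_difference_funpow:
  assumes "degree_le w \<phi>" "i \<in> A"
  shows "degree_le (w - real n * \<omega> i) ((difference (b i) ^^ n) \<phi>)"
  unfolding degree_le_def
proof (intro allI impI, elim conjE)
  fix M x
  assume M: "set_mset M \<subseteq> A" "w - real n * \<omega> i < (\<Sum>i\<in>#M. \<omega> i)"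
  have "mixed_difference ((difference (b i) ^^ n) \<phi>) M = mixed_difference \<phi> (replicate_mset n i + M)"
    by (simp add: mixed_difference_replicate)
  moreover have "int q dvd mixed_difference \<phi> (replicate_mset n i + M) x"
    using assms M unfolding degree_le_def by (auto simp del: fold_mset_union)
  ultimately show "int q dvd mixed_difference ((difference (b i) ^^ n) \<phi>) M x" by metis
qed

text \<open>Quantifying over all \<open>w\<close> and \<open>\<phi>\<close> makes this stable under
  sums of directions and applicable to functions that are themselves differences.\<close>

definition lowers :: "real \<Rightarrow> 'm \<Rightarrow> bool" where
  "lowers d h \<longleftrightarrow> (\<forall>w \<phi>. degree_le w \<phi> \<longrightarrow> degree_le (w - d) (difference h \<phi>))"

lemma lowers_zero: "lowers d 0"
  unfolding lowers_def
proof (intro allI impI)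
  fix w \<phi>
  have "mixed_difference (difference 0 \<phi>) M x = 0" for M x
    by (induction M arbitrary: x) (auto simp: difference_def)
  then show "degree_le (w - d) (difference 0 \<phi>)" by (simp add: degree_le_def)
qed

text \<open>With T_h the shift by h, 1 - T_h T_k = (1 - T_h) + T_h (1 - T_k), and shifts preserve
  the degree.\<close>

lemma lowers_add:
  assumes "lowers d h" "lowers d k"
  shows "lowers d (h + k)"
proof -
  have "difference (h + k) \<phi> = (\<lambda>x. difference h \<phi> x + difference k \<phi> (x + h))" for \<phi>
    by (simp add: difference_def fun_eq_iff algebra_simps)
  then show ?thesis
    using assms unfolding lowers_def by (auto intro!: degree_le_add degree_le_shift)
qed

lemma lowers_sum: "(\<And>i. i \<in> B \<Longrightarrow> lowers d (h i)) \<Longrightarrow> lowers d (\<Sum>i\<in>B. h i)"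
  by (induction B rule: infinite_finite_induct) (auto intro: lowers_zero lowers_add)

lemma lowers_of_nat_mult: "lowers d h \<Longrightarrow> lowers d (of_nat c * h)"
  using lowers_sum[of "{..<c}" d "\<lambda>_. h"] by simp

text \<open>In characteristic \<open>q\<close>, \<^term>\<open>difference (of_nat (q ^ s) * t)\<close> is the \<open>q ^ s\<close>-th power of
  \<^term>\<open>difference t\<close>.\<close>

lemma lowers_prime_power:
  assumes "i \<in> A" "d \<le> real (q ^ s) * \<omega> i"
  shows "lowers d (of_nat (q ^ s) * b i)"
  unfolding lowers_def
proof (intro allI impI)
  fix w \<phi>
  assume "degree_le w \<phi>"
  then have "degree_le (w - real (q ^ s) * \<omega> i) ((difference (b i) ^^ (q ^ s)) \<phi>)"
    using assms(1) by (rule degree_le_difference_funpow)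
  then have "degree_le (w - real (q ^ s) * \<omega> i) (difference (of_nat (q ^ s) * b i) \<phi>)"
    by (rule degree_le_cong) (rule difference_funpow_prime_power[OF prime_q])
  then show "degree_le (w - d) (difference (of_nat (q ^ s) * b i) \<phi>)"
    by (rule degree_le_mono) (use assms(2) in simp)
qed

text \<open>Pigeonhole: if no \<open>i\<close> occurs \<open>q ^ e i\<close> times in
  \<open>M\<close>, the weight of \<open>M\<close> is at most the sum of
  \<open>(q ^ e i - 1) / q ^ e i\<close>. Otherwise \<open>q ^ e i\<close> differences along
  \<open>b i\<close> amount modulo \<open>q\<close> to one difference along a period, which is
  0.\<close>

lemma degree_le_periodic:
  assumes fin: "finite A" and \<omega>: "\<And>i. i \<in> A \<Longrightarrow> \<omega> i = 1 / real (q ^ e i)"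
    and per: "\<And>i x. i \<in> A \<Longrightarrow> \<phi> (x + of_nat (q ^ e i) * b i) = \<phi> x"
  shows "degree_le (\<Sum>i\<in>A. 1 - \<omega> i) \<phi>"
  unfolding degree_le_def
proof (intro allI impI, elim conjE)
  fix M x
  assume M: "set_mset M \<subseteq> A" and gt: "(\<Sum>i\<in>A. 1 - \<omega> i) < (\<Sum>i\<in>#M. \<omega> i)"
  have q: "0 < q" using prime_q by (simp add: prime_gt_0_nat)
  have "\<exists>i\<in>A. q ^ e i \<le> count M i"
  proof (rule ccontr)
    assume "\<not> ?thesis"
    then have *: "Suc (count M i) \<le> q ^ e i" if "i \<in> A" for i
      using that by (auto simp: not_le)
    have "(\<Sum>i\<in>#M. \<omega> i) = (\<Sum>i\<in>A. real (count M i) * \<omega> i)"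
      using M fin by (rule sum_image_mset_eq_sum_count)
    also have "\<dots> \<le> (\<Sum>i\<in>A. 1 - \<omega> i)"
    proof (rule sum_mono)
      fix i assume i: "i \<in> A"
      have "real (Suc (count M i)) \<le> real (q ^ e i)" using *[OF i] by linarith
      then show "real (count M i) * \<omega> i \<le> 1 - \<omega> i"
        unfolding \<omega>[OF i] using q by (simp add: field_simps)
    qed
    finally show False using gt by simp
  qed
  then obtain i where i: "i \<in> A" "q ^ e i \<le> count M i" by blast
  then obtain N where N: "M = replicate_mset (q ^ e i) i + N"
    by (metis count_le_replicate_mset_subset_eq subset_mset.add_diff_inverse)
  have "difference (of_nat (q ^ e i) * b i) \<phi> y = 0" for y
    by (simp add: difference_def per[OF i(1)] del: of_nat_power)
  then have "int q dvd (difference (b i) ^^ (q ^ e i)) \<phi> y - (\<lambda>_. 0) y" for y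
    using difference_funpow_prime_power[OF prime_q, where t = "b i" and s = "e i" and \<phi> = \<phi> and x = y] by simp
  then have "int q dvd mixed_difference ((difference (b i) ^^ (q ^ e i)) \<phi>) N x - mixed_difference (\<lambda>_. 0) N x"
    by (rule dvd_mixed_difference)
  moreover have "mixed_difference (\<lambda>_. 0) N y = 0" for y
    by (induction N arbitrary: y) (auto simp: difference_def)
  ultimately show "int q dvd mixed_difference \<phi> M x"
    by (simp add: N mixed_difference_replicate)
qed

text \<open>The iterated difference of \<open>\<phi>\<close> at \<open>x\<close> along all \<open>h j\<close> reduces to \<open>\<phi> x\<close>, as the other
  values involved vanish, and it has negative degree.\<close>

lemma dvd_value_if_lowers:
  assumes "finite I" "degree_le w \<phi>" "\<And>j. j \<in> I \<Longrightarrow> lowers (d j) (h j)" "w < (\<Sum>j\<in>I. d j)"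
    and "\<And>J. J \<noteq> {} \<Longrightarrow> J \<subseteq> I \<Longrightarrow> \<phi> (x + (\<Sum>j\<in>J. h j)) = 0"
  shows "int q dvd \<phi> x"
  using assms
proof (induction I arbitrary: \<phi> w rule: finite_induct)
  case empty
  then show ?case by (auto simp: degree_le_def dest!: spec[of _ "{#}"])
next
  case (insert j I)
  have "int q dvd difference (h j) \<phi> x"
  proof (rule insert.IH[of "w - d j"])
    show "degree_le (w - d j) (difference (h j) \<phi>)"
      using insert.prems(1) insert.prems(2)[of j] by (simp add: lowers_def)
    show "w - d j < sum d I" using insert by simp
    fix J assume J: "J \<noteq> {}" "J \<subseteq> I"
    then have "j \<notin> J" "finite J" using insert.hyps finite_subset by auto
    \<comment> \<open>The two values of \<open>\<phi>\<close> belong to the sums over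
      \<open>J\<close> and \<open>insert j J\<close>, both nonempty subsets of
      \<open>insert j I\<close>.\<close>
    then show "difference (h j) \<phi> (x + sum h J) = 0"
      using insert.prems(4)[of J] insert.prems(4)[of "insert j J"] subset_insertI2[OF J(2)] J
      by (simp add: difference_def algebra_simps)
  qed (use insert.prems in auto)
  then show ?case
    using insert.prems(4)[of "{j}"] by (simp add: difference_def)
qed

end

text \<open>Vectors \<open>v j\<close> stand for elements of \<open>\<Oplus>i. C(q ^ e i)\<close> whose order divides \<open>q ^ a j\<close>.\<close>

lemma zero_sum_free_vectors_bound:
  fixes v :: "nat \<Rightarrow> 'i \<Rightarrow> int"
  assumes "prime q" "finite A" "finite I"
    and ord: "\<And>i j. i \<in> A \<Longrightarrow> j \<in> I \<Longrightarrow> int (q ^ e i) dvd int (q ^ a j) * v j i"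
    and nonneg: "\<And>i j. i \<in> A \<Longrightarrow> j \<in> I \<Longrightarrow> 0 \<le> v j i"
    and free: "\<And>J. J \<noteq> {} \<Longrightarrow> J \<subseteq> I \<Longrightarrow> \<exists>i\<in>A. \<not> int (q ^ e i) dvd (\<Sum>j\<in>J. v j i)"
  shows "(\<Sum>j\<in>I. 1 / real (q ^ a j)) \<le> (\<Sum>i\<in>A. 1 - 1 / real (q ^ e i))"
proof (rule ccontr)
  assume "\<not> ?thesis"
  define b :: "'i \<Rightarrow> 'i \<Rightarrow> int" where "b i = (\<lambda>k. if k = i then 1 else 0)" for i
  define \<phi> :: "('i \<Rightarrow> int) \<Rightarrow> int" where "\<phi> x = (if \<forall>i\<in>A. int (q ^ e i) dvd x i then 1 else 0)" for x
  \<comment> \<open>Coordinates outside \<open>A\<close> are set to 0, so that \<open>h j\<close> is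
    a combination of the \<open>b i\<close> with \<open>i \<in> A\<close>.\<close>
  define h :: "nat \<Rightarrow> 'i \<Rightarrow> int" where "h j = (\<lambda>i. if i \<in> A then v j i else 0)" for j
  have q: "0 < q" using assms(1) by (simp add: prime_gt_0_nat)
  interpret weighted_differences q A b "\<lambda>i. 1 / real (q ^ e i)"
    by standard fact
  have sum_fun: "sum f B k = (\<Sum>j\<in>B. f j k)" for f :: "'c \<Rightarrow> 'i \<Rightarrow> int" and B k
    by (induction B rule: infinite_finite_induct) auto
  have "int q dvd \<phi> 0"
  proof (rule dvd_value_if_lowers[OF \<open>finite I\<close>, where \<phi> = \<phi> and x = 0 and h = h])
    show "degree_le (\<Sum>i\<in>A. 1 - 1 / real (q ^ e i)) \<phi>"
    proof (rule degree_le_periodic[OF \<open>finite A\<close> refl])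
      fix i x
      have "int (q ^ e k) dvd (x + of_nat (q ^ e i) * b i) k \<longleftrightarrow> int (q ^ e k) dvd x k" for k
        by (auto simp: b_def of_nat_fun simp del: of_nat_power)
      then show "\<phi> (x + of_nat (q ^ e i) * b i) = \<phi> x" unfolding \<phi>_def by simp
    qed
    show "(\<Sum>i\<in>A. 1 - 1 / real (q ^ e i)) < (\<Sum>j\<in>I. 1 / real (q ^ a j))"
      using \<open>\<not> _\<close> by simp
    show "lowers (1 / real (q ^ a j)) (h j)" if j: "j \<in> I" for j
    proof -
      \<comment> \<open>\<open>q ^ s i\<close> is the factor that the order condition forces into
        \<open>v j i\<close>; truncated subtraction gives \<open>s i = 0\<close> when
        \<open>e i < a j\<close>, where nothing is forced.\<close>
      define s where "s i = e i - a j" for i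
      have "int (q ^ s i) dvd v j i" if i: "i \<in> A" for i
      proof (cases "a j \<le> e i")
        case True
        then have "int (q ^ a j) * int (q ^ s i) dvd int (q ^ a j) * v j i"
          using ord[OF i j] by (simp add: s_def flip: power_add)
        then show ?thesis using q by simp
      qed (simp add: s_def)
      \<comment> \<open>Nonnegativity makes the cofactors natural numbers, as
        \<open>lowers_of_nat_mult\<close> requires.\<close>
      then have "\<exists>c. v j i = int c * int (q ^ s i)" if i: "i \<in> A" for i
        using i nonneg[OF i j] by (metis dvd_def int_nat_eq int_ops(7) mult.commute nonneg_int_cases nat_int of_nat_dvd_iff)
      then obtain c where c: "\<And>i. i \<in> A \<Longrightarrow> v j i = int (c i) * int (q ^ s i)"
        by metis
      have "h j = (\<Sum>i\<in>A. of_nat (c i) * (of_nat (q ^ s i) * b i))"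
        using \<open>finite A\<close> by (auto simp: fun_eq_iff h_def sum_fun b_def c if_distrib of_nat_fun simp del: of_nat_power cong: if_cong)
      \<comment> \<open>The direction \<open>of_nat (q ^ s i) * b i\<close> lowers the degree by
        \<open>q ^ s i / q ^ e i\<close>, which is at least \<open>1 / q ^ a j\<close> because
        \<open>e i \<le> s i + a j\<close>.\<close>
      moreover have "1 / real (q ^ a j) \<le> real (q ^ s i) * (1 / real (q ^ e i))" for i
      proof -
        have "q ^ e i \<le> q ^ (s i + a j)"
          using q by (intro power_increasing) (auto simp: s_def)
        then have "real (q ^ e i) \<le> real (q ^ s i) * real (q ^ a j)"
          by (metis of_nat_le_iff of_nat_mult power_add)
        then show ?thesis using q by (simp add: field_simps)
      qed
      then have "lowers (1 / real (q ^ a j)) (of_nat (c i) * (of_nat (q ^ s i) * b i))" if "i \<in> A" for i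
        using that by (intro lowers_of_nat_mult[OF lowers_prime_power])
      ultimately show ?thesis
        by (simp only: lowers_sum)
    qed
    fix J assume J: "J \<noteq> {}" "J \<subseteq> I"
    then obtain i where "i \<in> A" "\<not> int (q ^ e i) dvd (\<Sum>j\<in>J. v j i)"
      using free by blast
    then show "\<phi> (0 + (\<Sum>j\<in>J. h j)) = 0"
      by (auto simp: \<phi>_def sum_fun h_def)
  qed
  \<comment> \<open>The zero vector lies in the lattice, so \<open>\<phi> 0 = 1\<close>.\<close>
  then have "q = 1" by (simp add: \<phi>_def)
  then show False using assms(1) by simp
qed

subsection \<open>Zero-sum submultisets of a UFIM\<close>

lemma partition_on_Un_Diff:
  assumes "K \<subseteq> J" "partition_on K P" "partition_on (J - K) Q"
  shows "partition_on J (P \<union> Q)"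
proof (rule partition_onI)
  show "\<Union> (P \<union> Q) = J"
    using assms by (auto simp: partition_on_def)
  show "{} \<notin> P \<union> Q" using assms by (auto simp: partition_on_def)
  fix p q assume "p \<in> P \<union> Q" "q \<in> P \<union> Q" "p \<noteq> q"
  moreover have "disjnt p q" if "p \<in> P" "q \<in> Q" for p q
  proof -
    have "p \<subseteq> K" "q \<subseteq> J - K"
      using that assms(2,3) by (auto simp: partition_on_def)
    then show ?thesis by (auto simp: disjnt_def)
  qed
  ultimately show "disjnt p q"
    using partition_onD2[OF assms(2)] partition_onD2[OF assms(3)]
    by (auto simp: pairwise_def disjnt_sym)
qed

context comm_group
begin

lemma finprod_subset_split:
  assumes "finite J" "K \<subseteq> J" "g \<in> J \<rightarrow> carrier G"
  shows "finprod G g J = finprod G g K \<otimes> finprod G g (J - K)"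
proof -
  have "finprod G g (K \<union> (J - K)) = finprod G g K \<otimes> finprod G g (J - K)"
    using assms finite_subset[OF assms(2,1)] by (intro finprod_Un_disjoint) auto
  moreover have "K \<union> (J - K) = J" using assms(2) by blast
  ultimately show ?thesis by simp
qed

lemma zero_sum_Diff:
  assumes "finite J" "K \<subseteq> J" "g \<in> J \<rightarrow> carrier G" "zero_sum G g J" "zero_sum G g K"
  shows "zero_sum G g (J - K)"
proof -
  have "finprod G g (J - K) \<in> carrier G"
    using assms(3) by (intro finprod_closed) auto
  then show ?thesis
    using finprod_subset_split[OF assms(1-3)] assms(4,5) by (simp add: zero_sum_def)
qed

text \<open>A zero-sum set that is not minimal splits into a proper zero-sum subset and its
  complement, which is again zero-sum; induction handles both.\<close>

lemma minimal_zero_sum_partition_exists: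
  assumes "finite J" "g \<in> J \<rightarrow> carrier G" "zero_sum G g J"
  shows "\<exists>Q. partition_on J Q \<and> (\<forall>I\<in>Q. minimal_zero_sum G g I)"
  using assms
proof (induction J rule: finite_psubset_induct)
  case (psubset J)
  \<comment> \<open>The empty set satisfies \<open>minimal_zero_sum\<close> but cannot be a block,
    so it is treated apart.\<close>
  consider "J = {}" | "J \<noteq> {}" "minimal_zero_sum G g J"
    | K where "K \<noteq> {}" "K \<subset> J" "zero_sum G g K"
    using psubset.prems by (auto simp: minimal_zero_sum_def)
  then show ?case
  proof cases
    case 1
    then show ?thesis by (auto simp: partition_on_empty)
  next
    case 2
    then show ?thesis by (intro exI[of _ "{J}"]) (simp add: partition_on_space)
  next
    case 3
    have "zero_sum G g (J - K)"
      using psubset 3 by (intro zero_sum_Diff) auto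
    then obtain Q where Q: "partition_on (J - K) Q" "\<forall>I\<in>Q. minimal_zero_sum G g I"
      using psubset.IH[of "J - K"] psubset.prems(1) 3 by blast
    obtain P where P: "partition_on K P" "\<forall>I\<in>P. minimal_zero_sum G g I"
      using psubset.IH[of K] psubset.prems(1) 3 by blast
    show ?thesis
      using partition_on_Un_Diff[OF _ P(1) Q(1)] 3 P Q by blast
  qed
qed

text \<open>Factorizations of \<open>J\<close> and of its complement combine to one of the whole multiset.\<close>

lemma UFIM_zero_sum_contains_block:
  assumes U: "UFIM G l g" and P: "irreducible_factorization G l g P"
    and J: "J \<subseteq> {1..l}" "J \<noteq> {}" "zero_sum G g J"
  shows "\<exists>I\<in>P. I \<subseteq> J"
proof -
  have g: "g \<in> {1..l} \<rightarrow> carrier G" and z: "zero_sum G g {1..l}"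
    using U by (auto simp: UFIM_def indexed_multiset_def)
  obtain Q where Q: "partition_on J Q" "\<forall>I\<in>Q. minimal_zero_sum G g I"
    using minimal_zero_sum_partition_exists[OF finite_subset[OF J(1)] _ J(3)] g J(1) by blast
  have "zero_sum G g ({1..l} - J)"
    using zero_sum_Diff[OF _ J(1) g z J(3)] by simp
  then obtain R where R: "partition_on ({1..l} - J) R" "\<forall>I\<in>R. minimal_zero_sum G g I"
    using minimal_zero_sum_partition_exists[of "{1..l} - J" g] g by blast
  have "irreducible_factorization G l g (Q \<union> R)"
    using partition_on_Un_Diff[OF J(1) Q(1) R(1)] Q R by (auto simp: irreducible_factorization_def)
  \<comment> \<open>Uniqueness makes the blocks of \<open>Q\<close> blocks of \<open>P\<close>;
    \<open>Q\<close> has one because \<open>J\<close> is nonempty.\<close>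
  then have "P = Q \<union> R"
    using U P by (auto simp: UFIM_def)
  moreover have "\<Union> Q = J" "{} \<notin> Q"
    using Q(1) by (auto simp: partition_on_def)
  ultimately show ?thesis
    using J(2) by blast
qed

text \<open>\<open>B\<close> and \<open>c\<close> are left open to serve both claims:
  \<open>B\<close> will be \<open>k_star\<close>, justified by the hypothesis on k(G) or by the
  p-group bound, and \<open>c\<close> will be P^-(|G|) or the prime of the p-group.\<close>

lemma UFIM_cross_number_le:
  assumes U: "UFIM G l g" and P: "irreducible_factorization G l g P"
    and B: "\<And>I. I \<subseteq> {1..l} \<Longrightarrow> zero_sum_free G g I \<Longrightarrow> (\<Sum>i\<in>I. 1 / real (ord (g i))) \<le> B"
    and c: "\<And>i. i \<in> {1..l} \<Longrightarrow> c \<le> real (ord (g i))" "0 < c"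
  shows "cross_number G l g \<le> B + real (card P) / c"
proof -
  have part: "partition_on {1..l} P"
    using P by (simp add: irreducible_factorization_def)
  then have finP: "finite P" by (rule finite_elements[rotated]) simp
  \<comment> \<open>\<open>t I\<close> is the element deleted from the block \<open>I\<close>; a
    nonempty zero-sum set avoiding all of them would contain a whole block.\<close>
  obtain t where t: "\<And>I. I \<in> P \<Longrightarrow> t I \<in> I"
    using partition_onD3[OF part] by (metis all_not_in_conv)
  define T where "T = t ` P"
  have T: "T \<subseteq> {1..l}"
    using t part by (auto simp: T_def partition_on_def)
  have "zero_sum_free G g ({1..l} - T)"
    unfolding zero_sum_free_def
  proof (intro allI impI notI, elim conjE)
    fix J assume J: "zero_sum G g J" "J \<noteq> {}" "J \<subseteq> {1..l} - T"
    then obtain I where "I \<in> P" "I \<subseteq> J"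
      using UFIM_zero_sum_contains_block[OF U P, of J] by blast
    then show False
      using t[of I] J(3) by (auto simp: T_def)
  qed
  then have "(\<Sum>i\<in>{1..l} - T. 1 / real (ord (g i))) \<le> B"
    using B by blast
  moreover have "(\<Sum>i\<in>T. 1 / real (ord (g i))) \<le> real (card P) / c"
  proof -
    have "(\<Sum>i\<in>T. 1 / real (ord (g i))) \<le> real (card T) * (1 / c)"
    proof (rule sum_bounded_above)
      fix i assume "i \<in> T"
      then have "c \<le> real (ord (g i))" using c(1) T by blast
      then show "1 / real (ord (g i)) \<le> 1 / c" using c(2) by (intro frac_le) auto
    qed
    also have "card T \<le> card P"
      unfolding T_def using finP by (rule card_image_le)
    then have "real (card T) * (1 / c) \<le> real (card P) / c"
      using c(2) by (simp add: divide_right_mono)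
    finally show ?thesis .
  qed
  ultimately show ?thesis
    unfolding cross_number_def using sum.subset_diff[OF T, of "\<lambda>i. 1 / real (ord (g i))"] by simp
qed

section \<open>Finiteness behind the maximum k(G)\<close>

lemma zero_sum_free_length:
  assumes fin: "finite (carrier G)" and g: "g \<in> {1..l} \<rightarrow> carrier G"
    and free: "zero_sum_free G g {1..l}"
  shows "l < card (carrier G)"
proof (rule ccontr)
  assume "\<not> l < card (carrier G)"
  \<comment> \<open>Counting the empty sum \<open>a 0\<close> there are \<open>l + 1\<close> partial
    sums, more than group elements. Two agree, and the terms between them sum to zero.\<close>
  define a where "a k = finprod G g {1..k}" for k
  have "a ` {0..l} \<subseteq> carrier G"
    using g unfolding a_def by (auto intro!: finprod_closed)
  then have "card (a ` {0..l}) \<le> card (carrier G)"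
    using fin by (rule card_mono[rotated])
  then have "card (a ` {0..l}) < card {0..l}"
    using \<open>\<not> _\<close> by simp
  then have "\<not> inj_on a {0..l}"
    by (rule pigeonhole)
  then obtain x y where xy: "x \<in> {0..l}" "y \<in> {0..l}" "x \<noteq> y" "a x = a y"
    unfolding inj_on_def by blast
  define j k where "j = min x y" and "k = max x y"
  have jk: "j < k" "k \<le> l" "a j = a k"
    using xy by (auto simp: j_def k_def min_def max_def)
  have gk: "g \<in> {1..k} \<rightarrow> carrier G" using g jk(2) by auto
  let ?F = "finprod G g ({1..k} - {1..j})"
  have "a k = a j \<otimes> ?F"
    unfolding a_def using jk(1) gk by (intro finprod_subset_split) auto
  also have "a j = a k" by (rule jk(3))
  finally have *: "a k = a k \<otimes> ?F" .
  have F: "?F \<in> carrier G" "a k \<in> carrier G"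
    using gk jk(1) unfolding a_def by (auto intro!: finprod_closed)
  have "?F = \<one>"
    using l_cancel_one'[OF F(2) F(1)] * by blast
  then have "zero_sum G g ({1..k} - {1..j})"
    by (simp add: zero_sum_def)
  moreover have "k \<in> {1..k} - {1..j}" "{1..k} - {1..j} \<subseteq> {1..l}"
    using jk(1,2) by auto
  ultimately show False
    using free[unfolded zero_sum_free_def, THEN spec, of "{1..k} - {1..j}"] by (metis empty_iff)
qed

lemma zero_sum_free_le_group_cross_number:
  assumes fin: "finite (carrier G)" and I: "finite I" and g: "g \<in> I \<rightarrow> carrier G - {\<one>}"
    and free: "zero_sum_free G g I"
  shows "(\<Sum>i\<in>I. 1 / real (ord (g i))) \<le> group_cross_number G"
proof -
  let ?X = "{cross_number G l g | l g. indexed_multiset G l g \<and> zero_sum_free G g {1..l}}"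
  \<comment> \<open>Cross numbers see only the values on \<open>{1..l}\<close>, and \<open>l\<close>
    is below the group order, so finitely many restricted functions produce
    \<open>?X\<close>.\<close>
  have "?X \<subseteq> (\<Union>l<card (carrier G). cross_number G l ` ({1..l} \<rightarrow>\<^sub>E carrier G))"
  proof
    fix x assume "x \<in> ?X"
    then obtain l g where *: "x = cross_number G l g" "indexed_multiset G l g" "zero_sum_free G g {1..l}"
      by blast
    then have g: "g \<in> {1..l} \<rightarrow> carrier G" by (auto simp: indexed_multiset_def)
    have "x = cross_number G l (restrict g {1..l})"
      unfolding *(1) cross_number_def by (intro sum.cong) auto
    then show "x \<in> (\<Union>l<card (carrier G). cross_number G l ` ({1..l} \<rightarrow>\<^sub>E carrier G))"
      using zero_sum_free_length[OF fin g *(3)] g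
      by (intro UN_I[of l]) (auto intro!: imageI restrict_PiE)
  qed
  moreover have "finite (\<Union>l<card (carrier G). cross_number G l ` ({1..l} \<rightarrow>\<^sub>E carrier G))"
    using fin by (auto intro!: finite_PiE)
  ultimately have finX: "finite ?X"
    by (rule finite_subset)
  obtain h where h: "bij_betw h {1..card I} I"
    using ex_bij_betw_nat_finite_1[OF I] by blast
  have "indexed_multiset G (card I) (g \<circ> h)"
    using g bij_betw_imp_funcset[OF h] by (auto simp: indexed_multiset_def)
  moreover have "zero_sum_free G (g \<circ> h) {1..card I}"
    unfolding zero_sum_free_def
  proof (intro allI impI notI, elim conjE)
    fix J assume J: "zero_sum G (g \<circ> h) J" "J \<noteq> {}" "J \<subseteq> {1..card I}"
    have hJ: "h ` J \<subseteq> I" "inj_on h J"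
      using J(3) h by (auto simp: bij_betw_def inj_on_subset)
    have "finprod G g (h ` J) = finprod G (\<lambda>j. g (h j)) J"
      using hJ g by (intro finprod_reindex) auto
    then have "zero_sum G g (h ` J)"
      using J(1) by (simp add: zero_sum_def comp_def)
    then show False
      using free hJ J(2) by (auto simp: zero_sum_free_def)
  qed
  moreover have "(\<Sum>i\<in>I. 1 / real (ord (g i))) = cross_number G (card I) (g \<circ> h)"
    unfolding cross_number_def using sum.reindex_bij_betw[OF h, of "\<lambda>i. 1 / real (ord (g i))"] by simp
  ultimately have "(\<Sum>i\<in>I. 1 / real (ord (g i))) \<in> ?X"
    by blast
  then show ?thesis
    unfolding group_cross_number_def by (rule Max_ge[OF finX])
qed

end

subsection \<open>Coordinates of a finite abelian group\<close>

lemma finite_sum_group_coordinates: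
  assumes "group G" "finite A" "\<And>k. k \<in> A \<Longrightarrow> 0 < N k"
    and iso: "G \<cong> sum_group A (\<lambda>k. integer_mod_group (N k))"
  obtains u :: "'a \<Rightarrow> 'k \<Rightarrow> int" where
    "\<forall>x\<in>carrier G. \<forall>k\<in>A. 0 \<le> u x k"
    "\<forall>x\<in>carrier G. \<forall>y\<in>carrier G. \<forall>k\<in>A.
       u (x \<otimes>\<^bsub>G\<^esub> y) k = (u x k + u y k) mod int (N k)"
    "\<forall>x\<in>carrier G. (\<forall>k\<in>A. int (N k) dvd u x k) \<longrightarrow> x = \<one>\<^bsub>G\<^esub>"
    "card (carrier G) = (\<Prod>k\<in>A. N k)"
proof -
  let ?H = "sum_group A (\<lambda>k. integer_mod_group (N k))"
  obtain u where u: "u \<in> iso G ?H" using iso by (auto simp: is_iso_def)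
  interpret G: group G by fact
  interpret H: group ?H by simp
  have hom: "u \<in> hom G ?H" and bij: "bij_betw u (carrier G) (carrier ?H)"
    using u by (auto simp: iso_def)
  \<comment> \<open>For finite \<open>A\<close> the finite support condition is void and the direct
    sum is the full product.\<close>
  have carr: "carrier ?H = (\<Pi>\<^sub>E k\<in>A. {0..<int (N k)})"
    using assms(2,3) by (auto simp: carrier_sum_group carrier_integer_mod_group PiE_iff extensional_def)
  have range: "0 \<le> u x k" "u x k < int (N k)" if "x \<in> carrier G" "k \<in> A" for x k
    using hom_in_carrier[OF hom that(1)] that(2) unfolding carr by (auto simp: PiE_iff)
  show ?thesis
  proof
    show "\<forall>x\<in>carrier G. \<forall>k\<in>A. 0 \<le> u x k"
      using range by blast
    show "\<forall>x\<in>carrier G. \<forall>y\<in>carrier G. \<forall>k\<in>A.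
        u (x \<otimes>\<^bsub>G\<^esub> y) k = (u x k + u y k) mod int (N k)"
      using hom_mult[OF hom] by simp
    show "\<forall>x\<in>carrier G. (\<forall>k\<in>A. int (N k) dvd u x k) \<longrightarrow> x = \<one>\<^bsub>G\<^esub>"
    proof (intro ballI impI)
      fix x assume x: "x \<in> carrier G" and dvd: "\<forall>k\<in>A. int (N k) dvd u x k"
      have "u x k = 0" if "k \<in> A" for k
        using range[OF x that] bspec[OF dvd that] mod_pos_pos_trivial[of "u x k" "int (N k)"]
        by (simp add: dvd_eq_mod_eq_0)
      moreover have "u x \<in> extensional A"
        using hom_in_carrier[OF hom x] unfolding carr by (auto simp: PiE_def)
      ultimately have "u x = \<one>\<^bsub>?H\<^esub>"
        by (auto simp: fun_eq_iff extensional_def)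
      then have "u x = u \<one>\<^bsub>G\<^esub>"
        using hom_one[OF hom] G.is_group H.is_group by simp
      then show "x = \<one>\<^bsub>G\<^esub>"
        using bij x by (auto simp: bij_betw_def inj_on_def)
    qed
    show "card (carrier G) = (\<Prod>k\<in>A. N k)"
      using bij_betw_same_card[OF bij] assms(2) unfolding carr by (simp add: card_PiE)
  qed
qed

section \<open>Comparison of K_1^* with k^*\<close>

lemma K1_star_cyclic_eq:
  "K1_star_cyclic q a = (real q ^ a - 1) / (real q ^ a - real q ^ (a - 1))"
  by (simp add: K1_star_cyclic_def K1_star_def)

text \<open>For one summand of order q^a, q^a - q^(a-1) = q^a (1 - 1/q), so K_1^* (1 - 1/q) equals
  (q^a - 1)/q^a.\<close>

lemma K1_star_eq_k_star_plus:
  assumes "\<forall>i\<in>{1..n}. prime (p i)" "\<forall>i\<in>{1..n}. \<forall>j\<in>{1..r i}. 1 \<le> e i j"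
  shows "K1_star n r p e
    = k_star n r p e + (\<Sum>i\<in>{1..n}. \<Sum>j\<in>{1..r i}. K1_star_cyclic (p i) (e i j) / real (p i))"
  unfolding K1_star_def k_star_def K1_star_cyclic_eq
  unfolding sum.distrib[symmetric]
proof (intro sum.cong refl)
  fix i j assume ij: "i \<in> {1..n}" "j \<in> {1..r i}"
  define q where "q = real (p i)"
  have q: "1 < q" using assms(1) ij(1) prime_gt_1_nat by (auto simp: q_def)
  obtain s where s: "e i j = Suc s"
    using assms(2) ij by (metis One_nat_def Suc_le_D)
  have nz: "q ^ s \<noteq> 0" "q - 1 \<noteq> 0" "q \<noteq> 0" using q by auto
  have *: "q ^ Suc s - q ^ s = q ^ s * (q - 1)" by (simp add: algebra_simps)
  have "(q ^ Suc s - 1) / (q ^ Suc s - q ^ s)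
      = (q ^ Suc s - 1) / q ^ Suc s + (q ^ Suc s - 1) / (q ^ Suc s - q ^ s) / q"
    unfolding * using nz by (simp add: field_simps)
  then show "(real (p i) ^ e i j - 1) / (real (p i) ^ e i j - real (p i) ^ (e i j - 1))
      = (real (p i) ^ e i j - 1) / real (p i) ^ e i j
      + (real (p i) ^ e i j - 1) / (real (p i) ^ e i j - real (p i) ^ (e i j - 1)) / real (p i)"
    unfolding s q_def diff_Suc_1 .
qed

section \<open>Prime-power coordinates and the p-group bound\<close>

context comm_group
begin

lemma prime_power_coordinates:
  assumes d: "prime_power_decomposition G n r p e"
  defines "A \<equiv> SIGMA i:{1..n}. {1..r i}" and "N \<equiv> \<lambda>(i, j). p i ^ e i j"
  obtains u :: "'a \<Rightarrow> nat \<times> nat \<Rightarrow> int" where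
    "\<forall>x\<in>carrier G. \<forall>k\<in>A. 0 \<le> u x k"
    "\<forall>x\<in>carrier G. \<forall>y\<in>carrier G. \<forall>k\<in>A.
       u (x \<otimes> y) k = (u x k + u y k) mod int (N k)"
    "\<forall>x\<in>carrier G. (\<forall>k\<in>A. int (N k) dvd u x k) \<longrightarrow> x = \<one>"
    "card (carrier G) = (\<Prod>k\<in>A. N k)"
proof -
  have "(\<lambda>(i, j). integer_mod_group (p i ^ e i j)) = (\<lambda>k. integer_mod_group (N k))"
    by (auto simp: N_def)
  then have iso: "G \<cong> sum_group A (\<lambda>k. integer_mod_group (N k))"
    using d by (simp add: prime_power_decomposition_def A_def)
  have pos: "0 < N k" if "k \<in> A" for k
    using that d prime_gt_0_nat by (auto simp: prime_power_decomposition_def A_def N_def)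
  have "finite A" by (simp add: A_def)
  then show ?thesis
    using finite_sum_group_coordinates[OF is_group _ pos iso] that by blast
qed

text \<open>Since \<open>e i j\<close> is positive, \<open>p i\<close> divides the group order, a
  power of \<open>q\<close>. The index \<open>j\<close> ensures that \<open>p i\<close> really
  occurs: for \<open>r i = 0\<close> it may be a different prime.\<close>

lemma finite_p_group_decomposition_prime:
  assumes "finite_p_group q G" and d: "prime_power_decomposition G n r p e"
    and ij: "i \<in> {1..n}" "j \<in> {1..r i}"
  shows "p i = q"
proof -
  let ?A = "SIGMA i:{1..n}. {1..r i}" and ?N = "\<lambda>(i, j). p i ^ e i j"
  obtain a where q: "prime q" and a: "card (carrier G) = q ^ a"
    using assms(1) by (auto simp: finite_p_group_def)
  have pi: "prime (p i)" "1 \<le> e i j"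
    using d ij by (auto simp: prime_power_decomposition_def)
  have "p i dvd p i ^ e i j" using pi(2) by (intro dvd_power) auto
  also have "p i ^ e i j dvd prod ?N ?A"
    using ij dvd_prodI[of ?A "(i, j)" ?N] by simp
  also have "prod ?N ?A = q ^ a"
    by (rule prime_power_coordinates[OF d]) (simp add: a)
  finally show ?thesis
    using pi(1) q by (metis prime_dvd_power primes_dvd_imp_eq)
qed


lemma p_group_zero_sum_free_bound:
  assumes q: "finite_p_group q G" and d: "prime_power_decomposition G n r p e"
    and I: "finite I" and g: "g \<in> I \<rightarrow> carrier G" and free: "zero_sum_free G g I"
  shows "(\<Sum>i\<in>I. 1 / real (ord (g i))) \<le> k_star n r p e"
proof -
  define A where "A = (SIGMA i:{1..n}. {1..r i})"
  define N where "N = (\<lambda>(i, j). p i ^ e i j)"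
  define E where "E = (\<lambda>(i, j). e i j)"
  obtain u :: "'a \<Rightarrow> nat \<times> nat \<Rightarrow> int" where
    nonneg: "\<forall>x\<in>carrier G. \<forall>k\<in>A. 0 \<le> u x k" and
    mult: "\<forall>x\<in>carrier G. \<forall>y\<in>carrier G. \<forall>k\<in>A.
      u (x \<otimes> y) k = (u x k + u y k) mod int (N k)" and
    inj: "\<forall>x\<in>carrier G. (\<forall>k\<in>A. int (N k) dvd u x k) \<longrightarrow> x = \<one>"
    by (rule prime_power_coordinates[OF d, folded A_def N_def])
  have N: "N k = q ^ E k" if "k \<in> A" for k
    using finite_p_group_decomposition_prime[OF q d] that by (auto simp: A_def N_def E_def)
  \<comment> \<open>Coordinates are additive only modulo \<open>N k\<close>, so each fact about sums
    is carried as a divisibility.\<close>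
  have mult_dvd: "int (N k) dvd u (x \<otimes> y) k - (u x k + u y k)"
    if "x \<in> carrier G" "y \<in> carrier G" "k \<in> A" for x y k
    using mult that by (simp add: mod_eq_dvd_iff[symmetric])
  have one_dvd: "int (N k) dvd u \<one> k" if "k \<in> A" for k
    using mult_dvd[OF one_closed one_closed that] by simp
  have pow_dvd: "int (N k) dvd u (x [^] (m::nat)) k - int m * u x k"
    if x: "x \<in> carrier G" and k: "k \<in> A" for x k m
  proof (induction m)
    case (Suc m)
    have "int (N k) dvd u (x [^] m \<otimes> x) k - (u (x [^] m) k + u x k)"
      using mult_dvd x k by simp
    from dvd_add[OF this Suc.IH] show ?case by (simp add: algebra_simps)
  qed (simp add: one_dvd k)
  have finprod_dvd: "int (N k) dvd u (finprod G g J) k - (\<Sum>j\<in>J. u (g j) k)"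
    if "finite J" "J \<subseteq> I" and k: "k \<in> A" for J k
    using that(1,2)
  proof (induction J rule: finite_induct)
    case (insert j J)
    have gJ: "g \<in> J \<rightarrow> carrier G" "g j \<in> carrier G" using insert.prems g by auto
    have "int (N k) dvd u (g j \<otimes> finprod G g J) k - (u (g j) k + u (finprod G g J) k)"
      using mult_dvd gJ k by simp
    moreover have "int (N k) dvd u (finprod G g J) k - (\<Sum>j\<in>J. u (g j) k)"
      using insert by auto
    ultimately show ?case
      using dvd_add[of "int (N k)" "u (g j \<otimes> finprod G g J) k - (u (g j) k + u (finprod G g J) k)"
          "u (finprod G g J) k - (\<Sum>j\<in>J. u (g j) k)"] insert.hyps gJ
      by (simp add: algebra_simps)
  qed (simp add: one_dvd k)
  obtain b where pq: "prime q" and "card (carrier G) = q ^ b"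
    using q by (auto simp: finite_p_group_def)
  then have "\<exists>a. ord x = q ^ a" if "x \<in> carrier G" for x
    using ord_dvd_group_order[OF that] divides_primepow_nat[OF pq] by (auto simp: order_def)
  then have "\<forall>i\<in>I. \<exists>a. ord (g i) = q ^ a"
    using g by auto
  then obtain a where a: "\<And>i. i \<in> I \<Longrightarrow> ord (g i) = q ^ a i"
    by (auto dest!: bchoice)
  have "(\<Sum>i\<in>I. 1 / real (ord (g i))) = (\<Sum>i\<in>I. 1 / real (q ^ a i))"
    using a by simp
  also have "\<dots> \<le> (\<Sum>k\<in>A. 1 - 1 / real (q ^ E k))"
  proof (rule zero_sum_free_vectors_bound[where v = "\<lambda>j. u (g j)", OF pq _ I])
    show "finite A" by (simp add: A_def)
    fix k j assume kj: "k \<in> A" "j \<in> I"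
    then have gj: "g j \<in> carrier G" using g by auto
    \<comment> \<open>At exponent \<open>ord (g j)\<close> the power is the identity, whose
      coordinates are divisible by \<open>N k\<close>.\<close>
    have "int (N k) dvd u \<one> k - int (q ^ a j) * u (g j) k"
      using pow_dvd[OF gj kj(1), of "ord (g j)", unfolded pow_ord_eq_1[OF gj]]
      unfolding a[OF kj(2)] .
    then have "int (N k) dvd int (q ^ a j) * u (g j) k"
      unfolding dvd_diff_right_iff[OF one_dvd[OF kj(1)]] .
    then show "int (q ^ E k) dvd int (q ^ a j) * u (g j) k"
      unfolding N[OF kj(1)] .
    show "0 \<le> u (g j) k" using nonneg gj kj(1) by blast
  next
    fix J assume J: "J \<noteq> {}" "J \<subseteq> I"
    then have "finite J" using I finite_subset by blast
    have "finprod G g J \<noteq> \<one>"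
      using free J by (auto simp: zero_sum_free_def zero_sum_def)
    moreover have "finprod G g J \<in> carrier G" using g J by (intro finprod_closed) auto
    ultimately obtain k where k: "k \<in> A" "\<not> int (N k) dvd u (finprod G g J) k"
      using inj by blast
    then show "\<exists>k\<in>A. \<not> int (q ^ E k) dvd (\<Sum>j\<in>J. u (g j) k)"
      using finprod_dvd[OF \<open>finite J\<close> J(2) k(1)] dvd_diff_left_iff N[OF k(1)]
      by metis
  qed
  also have "\<dots> = (\<Sum>k\<in>A. 1 - 1 / real (N k))"
    using N by simp
  also have "\<dots> = k_star n r p e"
  proof -
    have "0 < p i" if "i \<in> {1..n}" for i
      using that d prime_gt_0_nat by (auto simp: prime_power_decomposition_def)
    then show ?thesis
      unfolding k_star_def A_def N_def
      by (subst sum.Sigma) (auto intro!: sum.cong simp: diff_divide_distrib)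
  qed
  finally show ?thesis .
qed

text \<open>There is no nonidentity element, so \<open>l = 0\<close>. This settles the trivial
  group, where \<open>smallest_prime_divisor\<close> is unspecified.\<close>

lemma UFIM_trivial_cross_number:
  "UFIM G l g \<Longrightarrow> carrier G = {\<one>} \<Longrightarrow> cross_number G l g = 0"
  unfolding UFIM_def indexed_multiset_def cross_number_def by (cases "l = 0") (auto simp: Pi_iff)

end

lemma K1_star_nonneg:
  assumes "\<forall>i\<in>{1..n}. prime (p i)"
  shows "0 \<le> K1_star n r p e"
  unfolding K1_star_def
proof (intro sum_nonneg divide_nonneg_nonneg)
  fix i j assume "i \<in> {1..n}"
  then have "1 \<le> real (p i)" using assms prime_ge_1_nat by auto
  then show "0 \<le> real (p i) ^ e i j - 1" "0 \<le> real (p i) ^ e i j - real (p i) ^ (e i j - 1)"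
    by (auto intro: power_increasing)
qed

theorem proposition30:
  fixes G :: "('a, 'b) monoid_scheme"
    and n l :: nat
    and r p :: "nat \<Rightarrow> nat"
    and e :: "nat \<Rightarrow> nat \<Rightarrow> nat"
    and g :: "nat \<Rightarrow> 'a"
    and P :: "nat set set"
  assumes "comm_group G"
    and "finite (carrier G)"
    and "prime_power_decomposition G n r p e"
    and "UFIM G l g"
    and "irreducible_factorization G l g P"
  shows "(group_cross_number G = k_star n r p e \<and>
          real (card P) \<le>
            (\<Sum>i\<in>{1..n}. \<Sum>j\<in>{1..r i}.
               real (smallest_prime_divisor (card (carrier G))) / real (p i) * K1_star_cyclic (p i) (e i j))
          \<longrightarrow> cross_number G l g \<le> K1_star n r p e) \<and>
         ((\<exists>q. finite_p_group q G) \<and> real (card P) \<le> K1_star n r p e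
          \<longrightarrow> cross_number G l g \<le> K1_star n r p e)"
proof -
  interpret comm_group G by fact
  note d = assms(3)
  have dec: "\<forall>i\<in>{1..n}. prime (p i)" "\<forall>i\<in>{1..n}. \<forall>j\<in>{1..r i}. 1 \<le> e i j"
    using d by (auto simp: prime_power_decomposition_def)
  \<comment> \<open>\<open>C\<close> is the gap between K_1^* and k^*, available for the deleted
    elements.\<close>
  define C where "C = (\<Sum>i\<in>{1..n}. \<Sum>j\<in>{1..r i}. K1_star_cyclic (p i) (e i j) / real (p i))"
  have K1: "K1_star n r p e = k_star n r p e + C"
    unfolding C_def by (rule K1_star_eq_k_star_plus[OF dec])
  have g: "g i \<in> carrier G - {\<one>\<^bsub>G\<^esub>}" if "i \<in> {1..l}" for i
    using assms(4) that by (auto simp: UFIM_def indexed_multiset_def)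
  have ord: "ord (g i) dvd card (carrier G)" "ord (g i) \<noteq> 1" if "i \<in> {1..l}" for i
    using g[OF that] ord_dvd_group_order[of "g i"] ord_eq_1[of "g i"] by (auto simp: order_def)
  have card: "card (carrier G) > 0"
    using assms(2) by (auto simp: card_gt_0_iff)
  let ?s = "smallest_prime_divisor (card (carrier G))"
  have "cross_number G l g \<le> K1_star n r p e"
    if k: "group_cross_number G = k_star n r p e"
      and m: "real (card P) \<le> (\<Sum>i\<in>{1..n}. \<Sum>j\<in>{1..r i}. real ?s / real (p i) * K1_star_cyclic (p i) (e i j))"
  proof (cases "carrier G = {\<one>\<^bsub>G\<^esub>}")
    case True
    then show ?thesis
      using UFIM_trivial_cross_number[OF assms(4)] K1_star_nonneg[OF dec(1)] by simp
  next
    case False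
    then have "card (carrier G) \<noteq> 1"
      using one_closed by (metis card_1_singletonE singletonD)
    have fin: "finite {q. prime q \<and> q dvd card (carrier G)}"
      using card by (auto intro: finite_subset[OF _ finite_divisors_nat])
    have "?s \<in> {q. prime q \<and> q dvd card (carrier G)}"
      unfolding smallest_prime_divisor_def using fin prime_factor_nat[OF \<open>card (carrier G) \<noteq> 1\<close>]
      by (intro Min_in) auto
    then have s: "0 < ?s" by (auto simp: prime_gt_0_nat)
    have "cross_number G l g \<le> k_star n r p e + real (card P) / real ?s"
    proof (rule UFIM_cross_number_le[OF assms(4,5)])
      fix I assume I: "I \<subseteq> {1..l}" "zero_sum_free G g I"
      then show "(\<Sum>i\<in>I. 1 / real (ord (g i))) \<le> k_star n r p e"
        unfolding k[symmetric] using g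
        by (intro zero_sum_free_le_group_cross_number assms(2)) (auto intro: finite_subset)
    next
      fix i assume i: "i \<in> {1..l}"
      \<comment> \<open>A prime factor of the element order also divides |G|, so it lies between
        P^-(|G|) and that order.\<close>
      then obtain q where q: "prime q" "q dvd ord (g i)"
        using prime_factor_nat[OF ord(2)] by blast
      have "?s \<le> q"
        unfolding smallest_prime_divisor_def using fin q ord(1)[OF i] by (intro Min_le) (auto intro: dvd_trans)
      also have "q \<le> ord (g i)"
        using q(2) ord(1)[OF i] card by (intro dvd_imp_le) (auto intro!: Nat.gr0I)
      finally show "real ?s \<le> real (ord (g i))" by simp
    qed (use s in simp)
    moreover have "real (card P) / real ?s \<le> C"
    proof -
      \<comment> \<open>The assumed bound on the number of factors is exactly P^-(|G|) times
        \<open>C\<close>.\<close>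
      have "(\<Sum>i\<in>{1..n}. \<Sum>j\<in>{1..r i}. real ?s / real (p i) * K1_star_cyclic (p i) (e i j)) = real ?s * C"
        unfolding C_def sum_distrib_left by (intro sum.cong) auto
      then show ?thesis
        using m s by (simp add: field_simps)
    qed
    ultimately show ?thesis using K1 by simp
  qed
  moreover have "cross_number G l g \<le> K1_star n r p e"
    if q: "finite_p_group q G" and m: "real (card P) \<le> K1_star n r p e" for q
  proof -
    obtain b where pq: "prime q" and b: "card (carrier G) = q ^ b"
      using q by (auto simp: finite_p_group_def)
    have "cross_number G l g \<le> k_star n r p e + real (card P) / real q"
    proof (rule UFIM_cross_number_le[OF assms(4,5)])
      fix I assume I: "I \<subseteq> {1..l}" "zero_sum_free G g I"
      then show "(\<Sum>i\<in>I. 1 / real (ord (g i))) \<le> k_star n r p e"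
        using g by (intro p_group_zero_sum_free_bound[OF q d]) (auto intro: finite_subset)
    next
      fix i assume i: "i \<in> {1..l}"
      then obtain a where "ord (g i) = q ^ a" "a \<noteq> 0"
        using ord[OF i] divides_primepow_nat[OF pq] b by (metis power_0)
      then show "real q \<le> real (ord (g i))"
        using pq prime_ge_1_nat self_le_power[of q a] by simp
    qed (use pq prime_gt_0_nat in simp)
    \<comment> \<open>Every prime that occurs is \<open>q\<close>, so the assumed bound on the
      number of factors, divided by \<open>q\<close>, is exactly the gap \<open>C\<close>.\<close>
    moreover have "C = K1_star n r p e / real q"
    proof -
      have "C = (\<Sum>i\<in>{1..n}. \<Sum>j\<in>{1..r i}. K1_star_cyclic (p i) (e i j) / real q)"
        unfolding C_def using finite_p_group_decomposition_prime[OF q d] by (intro sum.cong) auto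
      also have "\<dots> = K1_star n r p e / real q"
        by (simp add: K1_star_def K1_star_cyclic_eq sum_divide_distrib)
      finally show ?thesis .
    qed
    ultimately show ?thesis
      using K1 m pq prime_gt_0_nat[OF pq] divide_right_mono[OF m, of "real q"] by simp
  qed
  ultimately show ?thesis by blast
qed

end
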